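(* Let $V=\mathrm{span}_{\mathbb{F}_q}\{x_1,\dots,x_n\}$ and let $\lambda=(\lambda_1\ge\dots\ge\lambda_n\ge0)$ be a partition with at most $n$ nonzero parts. Then $$S_\lambda(V)=(-1)^{|\lambda|}\sum_{\underline V\in\mathcal F}\ \prod_{i=1}^{n}\pi_i(\underline V)^{\frac{q^{\lambda_i}-1}{q-1}},$$ where $\mathcal F$ is the set of all complete flags $\underline V=(V=V_0\supsetneq V_1\supsetneq\dots\supsetneq V_{n-1}\supsetneq V_n=0)$ of $\mathbb{F}_q$-subspaces of $V$, and $\pi_i(\underline V)=\pi(V_{i-1}/V_i)$.
   Context: $q$ is a power of a prime $p$, $S=\mathbb{F}_q[x_1,\dots,x_n]$. For a subspace $W\subset S$ of dimension $k$ with basis $w_1,\dots,w_k$ and strictly decreasing nonnegative integers $\alpha_1>\dots>\alpha_k$, $A_\alpha(W)=\det(w_i^{q^{\alpha_j}})_{1\le i,j\le k}$; for a partition $\lambda$ with at most $k$ nonzero parts, $S_\lambda(W)=A_{\lambda+\delta_k}(W)/A_{\delta_k}(W)\in S$ with $\delta_k=(k-1,\dots,1,0)$ (independent of the basis). $|\lambda|=\sum_i\lambda_i$. For a finite-dimensional subspace $W\subset S$, $\pi(W)$ denotes the product of all nonzero elements of $W$. For subspaces $W\subseteq W'$ of $S$, $f_W(X)=\prod_{w\in W}(X+w)$ is an $\mathbb{F}_q$-linear map $S\to S$ with kernel $W$, and $W'/W:=f_W(W')\subset S$, a subspace of dimension $\dim W'-\dim W$. *)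

theory Defs
  imports "HOL-Library.Poly_Mapping" "Jordan_Normal_Form.Determinant"
begin

text \<open>The polynomial ring S = F_q[x_0,...,x_(n-1)] is modelled as the monoid algebra
  (nat =>0 nat) =>0 a over a finite field 'a with q = CARD('a) elements.
  Variables are indexed from 0.\<close>

type_synonym 'a mpoly = "(nat \<Rightarrow>\<^sub>0 nat) \<Rightarrow>\<^sub>0 'a"

definition const :: "'a::zero \<Rightarrow> 'a mpoly" where
  "const c = Poly_Mapping.single 0 c"

definition var :: "nat \<Rightarrow> 'a::{zero,one} mpoly" where
  "var i = Poly_Mapping.single (Poly_Mapping.single i 1) 1"

definition fq_subspace :: "'a::field mpoly set \<Rightarrow> bool" where
  "fq_subspace W \<longleftrightarrow> 0 \<in> W \<and> (\<forall>a\<in>W. \<forall>b\<in>W. a + b \<in> W)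
      \<and> (\<forall>c::'a. \<forall>w\<in>W. const c * w \<in> W)"

definition varspan :: "nat \<Rightarrow> 'a::field mpoly set" where
  "varspan n = {(\<Sum>i<n. const (c i) * var i) | c. True}"

definition prod_nz :: "'a::comm_ring_1 mpoly set \<Rightarrow> 'a mpoly" where
  "prod_nz W = (\<Prod>w\<in>W - {0}. w)"

definition fW :: "'a::comm_ring_1 mpoly set \<Rightarrow> 'a mpoly \<Rightarrow> 'a mpoly" where
  "fW W X = (\<Prod>w\<in>W. X + w)"

definition quot_sp :: "'a::comm_ring_1 mpoly set \<Rightarrow> 'a mpoly set \<Rightarrow> 'a mpoly set" where
  "quot_sp W' W = fW W ` W'"

definition Aalt :: "nat \<Rightarrow> 'a::comm_ring_1 mpoly list \<Rightarrow> nat list \<Rightarrow> 'a mpoly" where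
  "Aalt q ws alpha = det (mat (length ws) (length ws) (\<lambda>(i,j). (ws ! i) ^ (q ^ (alpha ! j))))"

definition delta :: "nat \<Rightarrow> nat list" where
  "delta k = map (\<lambda>i. k - 1 - i) [0..<k]"

text \<open>S_lambda(W) = A_(lambda+delta)(W) / A_delta(W), computed with respect to the basis ws
  (the quotient is exact in S and independent of the basis).\<close>
definition moore_schur :: "nat \<Rightarrow> 'a::comm_ring_1 mpoly list \<Rightarrow> nat list \<Rightarrow> 'a mpoly" where
  "moore_schur q ws lam =
     (THE s. s * Aalt q ws (delta (length ws))
             = Aalt q ws (map2 (+) lam (delta (length ws))))"

definition complete_flags :: "nat \<Rightarrow> 'a::field mpoly set \<Rightarrow> 'a mpoly set list set" where
  "complete_flags n V = {Vs. length Vs = n + 1 \<and> Vs ! 0 = V \<and> Vs ! n = {0}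
       \<and> (\<forall>i\<le>n. fq_subspace (Vs ! i) \<and> Vs ! i \<subseteq> V)
       \<and> (\<forall>i<n. Vs ! (Suc i) \<subset> Vs ! i)}"

end

theory Submission
  imports Defs
begin

text \<open>The key identity is that, for a subspace V of dimension n and w in V,
  the sum of f_H(w) over all hyperplanes H of V equals w^(q^(n-1)).
  It follows by induction on n: pick a hyperplane V' containing w. The term H = V' vanishes, and the
  hyperplanes H with a given intersection H' with V' contribute f_H'(w)^q in total, because
  f_(H'+<u>)(w) = f_H'(w)^q - f_H'(u)^(q-1) f_H'(w) and
  the sum of (b + c e)^(q-1) over c in F_q is -e^(q-1).

  Raise the identity to the power q^m, m = lambda_1, and substitute it in the first column of
  A_(lambda+delta)(V). In a basis (v, h_2, ..., h_n) with h_2, ..., h_n spanning H, the first column of the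
  determinant belonging to H is (f_H(v)^(q^m), 0, ..., 0), so the determinant is a product; similarly
  A_delta(V) = f_H(v) A_delta(H). Since pi(V/H) = -f_H(v)^(q-1), this expresses S_lambda(V) as a sum over H of
  (-1)^m pi(V/H)^((q^m-1)/(q-1)) S_(lambda_2,...,lambda_n)(H), and induction gives the sum over flags.\<close>

section \<open>Frobenius identities over a finite field\<close>

lemma const_0 [simp]: "const 0 = 0"
  by (simp add: const_def)

lemma const_1 [simp]: "const 1 = 1"
  by (simp add: const_def)

lemma const_add: "const (a + b) = const a + const b"
  by (simp add: const_def single_add)

lemma const_mult: "const (a * b) = const a * const b"
  by (simp add: const_def mult_single)

lemma const_uminus: "const (- a) = - const a"
  by (simp add: const_def single_uminus)

lemma const_power: "const (a ^ k) = const a ^ k"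
  by (induction k) (simp_all add: const_mult)

lemma const_eq_iff [simp]: "const a = const b \<longleftrightarrow> a = b"
  by (metis const_def lookup_single_eq)

lemma const_eq_0_iff [simp]: "const a = 0 \<longleftrightarrow> a = 0"
  by (metis const_0 const_eq_iff)

text \<open>The \<open>itself\<close> parameter makes the coefficient field part of the locale,
  since the number \<open>q\<close> alone does not determine it.\<close>

locale finite_field_mpoly =
  fixes q :: nat and F :: "'a::{field,finite} itself"
  assumes q_eq: "q = card (UNIV :: 'a set)"
begin

lemma q_ge_2: "2 \<le> q"
proof -
  have "card {0, 1 :: 'a} \<le> card (UNIV :: 'a set)"
    by (rule card_mono) auto
  then show ?thesis
    by (simp add: q_eq)
qed

lemma card_units: "card (UNIV - {0 :: 'a}) = q - 1"
  by (simp add: q_eq card_Diff_singleton)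

text \<open>Multiplication by a permutes the nonzero field elements, so their product P satisfies P
  = a^(q-1) P.\<close>

lemma pow_q_minus_1: "(a::'a) ^ (q - 1) = 1" if "a \<noteq> 0"
proof -
  let ?U = "UNIV - {0 :: 'a}"
  have "bij_betw ((*) a) ?U ?U"
    by (rule bij_betw_byWitness[where f' = "\<lambda>x. x / a"]) (use that in auto)
  then have "(\<Prod>x\<in>?U. x) = (\<Prod>x\<in>?U. a * x)"
    by (rule prod.reindex_bij_betw[symmetric])
  also have "\<dots> = a ^ (q - 1) * (\<Prod>x\<in>?U. x)"
    by (simp add: prod.distrib card_units)
  finally show ?thesis
    by simp
qed

lemma pow_q: "(a::'a) ^ q = a"
proof (cases "a = 0")
  case True
  then show ?thesis using q_ge_2 by simp
next
  case False
  have "a ^ q = a ^ Suc (q - 1)"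
    using q_ge_2 by simp
  also have "\<dots> = a"
    using pow_q_minus_1[OF False] by simp
  finally show ?thesis .
qed

lemma const_pow_q: "const (a::'a) ^ q = const a"
  by (metis const_power pow_q)

lemma const_pow_q_pow: "const (a::'a) ^ (q ^ k) = const a"
  by (induction k) (simp_all add: power_mult const_pow_q)

lemma inj_scale: "inj_on (\<lambda>c. const c * u) A" if "u \<noteq> 0" for u :: "'a mpoly"
  using that by (auto simp: inj_on_def)

section \<open>Characteristic and additivity of the q-power map\<close>

lemma of_nat_q: "(of_nat q :: 'a mpoly) = 0"
proof -
  have "(\<Sum>c\<in>(UNIV :: 'a set). const c) = (\<Sum>c\<in>(UNIV :: 'a set). const (c + 1))"
    by (rule sum.reindex_bij_betw[symmetric])
       (rule bij_betw_byWitness[where f' = "\<lambda>x. x - 1"], auto)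
  then show ?thesis
    by (simp add: const_add sum.distrib q_eq)
qed

lemma add_pow_q: "(x + y) ^ q = x ^ q + y ^ q" for x y :: "'a mpoly"
proof (cases "y = 0")
  case True
  then show ?thesis using q_ge_2 by simp
next
  case False
  \<comment> \<open>two polynomials of degree q with equal leading coefficients that agree on the q multiples of y\<close>
  define P where "P = [:y, 1:] ^ q"
  define R where "R = monom 1 q + [:y ^ q:]"
  have "P = R"
  proof (rule poly_eqI_degree_lead_coeff[where n = q and A = "range (\<lambda>d::'a. const d * y)"])
    show "coeff P q = coeff R q"
      using q_ge_2 by (simp add: P_def R_def coeff_linear_power coeff_pCons split: nat.split)
    show "q \<le> card (range (\<lambda>d::'a. const d * y))"
      using inj_scale[OF False] by (simp add: card_image q_eq)
    show "degree P \<le> q"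
      by (simp add: P_def degree_power_eq)
    show "degree R \<le> q"
      unfolding R_def by (rule degree_add_le) (auto simp: degree_monom_le)
  next
    fix z assume "z \<in> range (\<lambda>d::'a. const d * y)"
    then obtain d :: 'a where z: "z = const d * y" by auto
    have "(y + const d * y) ^ q = (const (1 + d) * y) ^ q"
      by (simp add: const_add algebra_simps)
    also have "\<dots> = const (1 + d) * y ^ q"
      by (simp only: power_mult_distrib const_pow_q)
    also have "\<dots> = z ^ q + y ^ q"
      by (simp add: z power_mult_distrib const_pow_q const_add distrib_right)
    finally show "poly P z = poly R z"
      by (simp add: P_def R_def z poly_monom)
  qed
  then have "poly P x = poly R x" by simp
  then show ?thesis
    by (simp add: P_def R_def poly_monom add.commute)
qed

lemma add_pow_q_pow: "(x + y) ^ (q ^ k) = x ^ (q ^ k) + y ^ (q ^ k)" for x y :: "'a mpoly"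
  by (induction k arbitrary: x y) (simp_all add: power_mult add_pow_q)

lemma sum_pow_q_pow: "(\<Sum>i\<in>A. f i) ^ (q ^ k) = (\<Sum>i\<in>A. f i ^ (q ^ k))" for f :: "'b \<Rightarrow> 'a mpoly"
  using q_ge_2 by (induction A rule: infinite_finite_induct) (simp_all add: add_pow_q_pow)

text \<open>Since -1 is a constant it is fixed by the q-power map; no case distinction on the parity
  of q is required.\<close>

lemma minus_1_pow_q: "(- 1) ^ q = (- 1 :: 'a mpoly)"
  using const_pow_q[of "- 1"] by (simp add: const_uminus)

lemma minus_1_pow_q_pow: "(- 1) ^ (q ^ k) = (- 1 :: 'a mpoly)"
  by (induction k) (simp_all add: power_mult minus_1_pow_q)

section \<open>Products and power sums along a line\<close>

text \<open>For nonzero u both sides are monic polynomials in x of degree q-1 that vanish at the q-1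
  nonzero multiples of u.\<close>

lemma prod_add_scale_nz:
  "(\<Prod>c\<in>UNIV - {0::'a}. x + const c * u) = x ^ (q - 1) - u ^ (q - 1)" for x u :: "'a mpoly"
proof (cases "u = 0")
  case True
  then show ?thesis using q_ge_2 by (simp add: card_units)
next
  case False
  let ?U = "UNIV - {0::'a}"
  define P where "P = (\<Prod>c\<in>?U. [:const c * u, 1:])"
  define R where "R = monom 1 (q - 1) - [:u ^ (q - 1):]"
  have deg: "degree P = q - 1"
    unfolding P_def by (subst degree_prod_eq_sum_degree) (auto simp: card_units)
  have "P = R"
  proof (rule poly_eqI_degree_lead_coeff[where n = "q - 1" and A = "(\<lambda>d. const d * u) ` ?U"])
    have "lead_coeff P = 1"
      unfolding P_def by (simp add: lead_coeff_prod)
    then show "coeff P (q - 1) = coeff R (q - 1)"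
      using q_ge_2 deg by (simp add: R_def coeff_pCons split: nat.split)
    show "q - 1 \<le> card ((\<lambda>d. const d * u) ` ?U)"
      using inj_scale[OF False] by (simp add: card_image card_units)
    show "degree P \<le> q - 1"
      using deg by simp
    show "degree R \<le> q - 1"
      unfolding R_def by (rule degree_diff_le) (auto simp: degree_monom_le)
  next
    fix z assume "z \<in> (\<lambda>d. const d * u) ` ?U"
    then obtain d :: 'a where z: "z = const d * u" and d: "d \<noteq> 0" by auto
    have "poly P z = 0"
      unfolding P_def poly_prod z
      by (rule prod_zero, simp, rule bexI[of _ "- d"]) (use d in \<open>auto simp: const_uminus\<close>)
    moreover have "poly R z = 0"
      using pow_q_minus_1[OF d]
      by (simp add: R_def z poly_monom power_mult_distrib flip: const_power)
    ultimately show "poly P z = poly R z" by simp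
  qed
  then have "poly P x = poly R x" by simp
  then show ?thesis
    by (simp add: P_def R_def poly_monom poly_prod add.commute)
qed

text \<open>The case x = 0, which contains Wilson's theorem for the field; it evaluates pi on a
  line.\<close>

lemma prod_scale_nz: "(\<Prod>c\<in>UNIV - {0::'a}. const c * u) = - (u ^ (q - 1))" for u :: "'a mpoly"
  using prod_add_scale_nz[of 0 u] q_ge_2 by simp

lemma prod_add_scale: "(\<Prod>c\<in>(UNIV :: 'a set). x + const c * u) = x ^ q - u ^ (q - 1) * x"
  for x u :: "'a mpoly"
proof -
  have "(\<Prod>c\<in>(UNIV :: 'a set). x + const c * u) = x * (\<Prod>c\<in>UNIV - {0::'a}. x + const c * u)"
    by (subst prod.remove[of _ 0]) auto
  also have "\<dots> = x ^ Suc (q - 1) - u ^ (q - 1) * x"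
    unfolding prod_add_scale_nz by (simp add: right_diff_distrib mult.commute)
  finally show ?thesis
    using q_ge_2 by simp
qed

text \<open>For nonzero e the left side is a polynomial in b of degree at most q-1. At each of the q
  points d e it equals -e^(q-1), because the (q-1)-th powers of all field elements sum to q-1 = -1;
  hence it is constant.\<close>

lemma sum_add_scale_pow: "(\<Sum>c\<in>(UNIV :: 'a set). (b + const c * e) ^ (q - 1)) = - (e ^ (q - 1))"
  for b e :: "'a mpoly"
proof (cases "e = 0")
  case True
  then show ?thesis using q_ge_2 of_nat_q by (simp add: q_eq[symmetric])
next
  case False
  define P where "P = (\<Sum>c\<in>(UNIV :: 'a set). [:const c * e, 1:] ^ (q - 1))"
  define R where "R = [:- (e ^ (q - 1)):]"
  have "P = R"
  proof (rule poly_eqI_degree[where A = "range (\<lambda>d::'a. const d * e)"])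
    have card: "card (range (\<lambda>d::'a. const d * e)) = q"
      using inj_scale[OF False] by (simp add: card_image q_eq)
    have "degree P \<le> q - 1"
      unfolding P_def by (rule degree_sum_le) (simp_all add: degree_power_eq)
    then show "degree P < card (range (\<lambda>d::'a. const d * e))"
      using card q_ge_2 by simp
    show "degree R < card (range (\<lambda>d::'a. const d * e))"
      using card q_ge_2 by (simp add: R_def)
  next
    fix z assume "z \<in> range (\<lambda>d::'a. const d * e)"
    then obtain d :: 'a where z: "z = const d * e" by auto
    have "poly P z = (\<Sum>c\<in>(UNIV :: 'a set). (const c * e + const d * e) ^ (q - 1))"
      by (simp add: P_def z poly_sum)
    also have "\<dots> = (\<Sum>c\<in>(UNIV :: 'a set). const ((c + d) ^ (q - 1))) * e ^ (q - 1)"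
      by (simp add: sum_distrib_right const_add const_power power_mult_distrib flip: distrib_right)
    also have "(\<Sum>c\<in>(UNIV :: 'a set). const ((c + d) ^ (q - 1))) = (\<Sum>c\<in>(UNIV :: 'a set). const (c ^ (q - 1)))"
      by (rule sum.reindex_bij_betw) (rule bij_betw_byWitness[where f' = "\<lambda>x. x - d"], auto)
    also have "\<dots> = (\<Sum>c\<in>UNIV - {0::'a}. const (c ^ (q - 1)))"
      using q_ge_2 by (subst sum.remove[of _ 0]) auto
    also have "\<dots> = (\<Sum>c\<in>UNIV - {0::'a}. 1)"
      by (rule sum.cong) (simp_all add: pow_q_minus_1[unfolded One_nat_def])
    also have "\<dots> = - 1"
      using of_nat_q q_ge_2 by (simp add: card_units of_nat_diff)
    finally show "poly P z = poly R z"
      by (simp add: R_def)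
  qed
  then have "poly P b = poly R b" by simp
  then show ?thesis
    by (simp add: P_def R_def poly_sum add.commute)
qed

end

section \<open>Subspaces and the maps f_W\<close>

lemma fq_subspace_0: "fq_subspace W \<Longrightarrow> 0 \<in> W"
  and fq_subspace_add: "fq_subspace W \<Longrightarrow> x \<in> W \<Longrightarrow> y \<in> W \<Longrightarrow> x + y \<in> W"
  and fq_subspace_scale: "fq_subspace W \<Longrightarrow> x \<in> W \<Longrightarrow> const c * x \<in> W"
  by (auto simp: fq_subspace_def)

lemma fq_subspace_uminus: "fq_subspace W \<Longrightarrow> x \<in> W \<Longrightarrow> - x \<in> W"
  using fq_subspace_scale[of W x "- 1"] by (simp add: const_uminus)

lemma fq_subspace_diff: "fq_subspace W \<Longrightarrow> x \<in> W \<Longrightarrow> y \<in> W \<Longrightarrow> x - y \<in> W"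
  using fq_subspace_add[of W x "- y"] fq_subspace_uminus[of W y] by simp

lemma fq_subspace_scaleD: "x \<in> W" if "fq_subspace W" "const c * x \<in> W" "c \<noteq> 0"
proof -
  have "const (inverse c) * (const c * x) \<in> W"
    by (rule fq_subspace_scale[OF that(1,2)])
  also have "const (inverse c) * (const c * x) = x"
    using that by (simp flip: mult.assoc const_mult)
  finally show ?thesis .
qed

lemma fq_subspace_zero: "fq_subspace {0}"
  by (simp add: fq_subspace_def)

lemma fq_subspace_Int: "fq_subspace U \<Longrightarrow> fq_subspace W \<Longrightarrow> fq_subspace (U \<inter> W)"
  by (auto simp: fq_subspace_def)

section \<open>Adjoining one vector to a subspace\<close>

text \<open>The span of u and W, written as an image of pairs so that cardinalities and products can
  be reindexed along \<open>inj_on_adjoin\<close>.\<close>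

definition adjoin :: "'a::field mpoly \<Rightarrow> 'a mpoly set \<Rightarrow> 'a mpoly set" where
  "adjoin u W = (\<lambda>(c, h). const c * u + h) ` (UNIV \<times> W)"

lemma mem_adjoin: "x \<in> adjoin u W \<longleftrightarrow> (\<exists>c. \<exists>h\<in>W. x = const c * u + h)"
  by (auto simp: adjoin_def)

lemma adjoin_subset: "fq_subspace V \<Longrightarrow> u \<in> V \<Longrightarrow> W \<subseteq> V \<Longrightarrow> adjoin u W \<subseteq> V"
  by (auto simp: adjoin_def intro!: fq_subspace_add fq_subspace_scale)

lemma subset_adjoin: "W \<subseteq> adjoin u W"
  by (auto simp: mem_adjoin intro!: exI[of _ 0])

lemma generator_in_adjoin: "fq_subspace W \<Longrightarrow> u \<in> adjoin u W"
  by (auto simp: mem_adjoin intro!: exI[of _ 1] bexI[of _ 0] fq_subspace_0)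

lemma fq_subspace_adjoin:
  assumes W: "fq_subspace W"
  shows "fq_subspace (adjoin u W)"
  unfolding fq_subspace_def
proof (intro conjI ballI allI)
  show "0 \<in> adjoin u W"
    using subset_adjoin[of W u] fq_subspace_0[OF W] by blast
next
  fix a b assume "a \<in> adjoin u W" "b \<in> adjoin u W"
  then obtain c h d k where "a = const c * u + h" "h \<in> W" "b = const d * u + k" "k \<in> W"
    by (auto simp: mem_adjoin)
  then show "a + b \<in> adjoin u W"
    unfolding mem_adjoin using fq_subspace_add[OF W]
    by (intro exI[of _ "c + d"] bexI[of _ "h + k"]) (auto simp: const_add algebra_simps)
next
  fix c a assume "a \<in> adjoin u W"
  then obtain d h where "a = const d * u + h" "h \<in> W"
    by (auto simp: mem_adjoin)
  then show "const c * a \<in> adjoin u W"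
    unfolding mem_adjoin using fq_subspace_scale[OF W]
    by (intro exI[of _ "c * d"] bexI[of _ "const c * h"]) (auto simp: const_mult algebra_simps)
qed

text \<open>Two representations with different c would put a nonzero multiple of u into W.\<close>

lemma inj_on_adjoin:
  assumes W: "fq_subspace W" and u: "u \<notin> W"
  shows "inj_on (\<lambda>(c, h). const c * u + h) (UNIV \<times> W)"
proof (rule inj_onI, clarsimp)
  fix c h d k assume h: "h \<in> W" and k: "k \<in> W" and eq: "const c * u + h = const d * u + k"
  have "const (c - d) * u = k - h"
    using eq const_add[of "c - d" d] by (simp add: algebra_simps)
  then have "const (c - d) * u \<in> W"
    using fq_subspace_diff[OF W k h] by simp
  then have "c = d"
    using fq_subspace_scaleD[OF W] u by force
  then show "c = d \<and> h = k"
    using eq by simp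
qed

definition fq_linear :: "('a::field mpoly \<Rightarrow> 'a mpoly) \<Rightarrow> bool" where
  "fq_linear f \<longleftrightarrow> (\<forall>x y. f (x + y) = f x + f y) \<and> (\<forall>c x. f (const c * x) = const c * f x)"

lemma fq_linear_add: "fq_linear f \<Longrightarrow> f (x + y) = f x + f y"
  and fq_linear_scale: "fq_linear f \<Longrightarrow> f (const c * x) = const c * f x"
  by (auto simp: fq_linear_def)

lemma fq_linear_0: "fq_linear f \<Longrightarrow> f 0 = 0"
  using fq_linear_scale[of f 0 0] by simp

lemma fq_linear_sum: "fq_linear f \<Longrightarrow> f (\<Sum>i\<in>A. g i) = (\<Sum>i\<in>A. f (g i))"
  by (induction A rule: infinite_finite_induct) (simp_all add: fq_linear_add fq_linear_0)

lemma fW_eq_0: "fW W x = 0" if "fq_subspace W" "finite W" "x \<in> W"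
  unfolding fW_def
  by (rule prod_zero) (use that fq_subspace_uminus[OF that(1,3)] in \<open>auto intro!: bexI[of _ "- x"]\<close>)

lemma fW_neq_0: "fW W x \<noteq> 0" if "fq_subspace W" "finite W" "x \<notin> W"
proof -
  have "x + w \<noteq> 0" if "w \<in> W" for w
    using that \<open>x \<notin> W\<close> fq_subspace_uminus[OF \<open>fq_subspace W\<close> that] by (metis add_eq_0_iff2)
  then show ?thesis
    using \<open>finite W\<close> by (simp add: fW_def)
qed

lemma fW_zero_space: "fW {0} x = x"
  by (simp add: fW_def)

text \<open>Dimension is measured by cardinality: the k-dimensional subspaces are those with q^k elements.\<close>

definition subspaces_card :: "nat \<Rightarrow> 'a::field mpoly set \<Rightarrow> 'a mpoly set set" where
  "subspaces_card N V = {H. fq_subspace H \<and> H \<subseteq> V \<and> card H = N}"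

lemma finite_subspaces_card: "finite V \<Longrightarrow> finite (subspaces_card N V)"
  by (rule finite_subset[of _ "Pow V"]) (auto simp: subspaces_card_def)

context finite_field_mpoly
begin

section \<open>Dimension counting by cardinality\<close>

lemma finite_card_q_pow: "finite W" if "card W = q ^ k"
  using that q_ge_2 by (intro card_ge_0_finite) simp

lemma card_adjoin: "card (adjoin u W) = q * card W" if "fq_subspace W" "u \<notin> W" for W :: "'a mpoly set"
  unfolding adjoin_def by (simp add: card_image inj_on_adjoin[OF that] card_cartesian_product q_eq)

lemma adjoin_eq:
  fixes V W :: "'a mpoly set"
  assumes "fq_subspace V" "fq_subspace W" "W \<subseteq> V" "u \<in> V" "u \<notin> W"
    and "card V = q * card W" "finite V"
  shows "adjoin u W = V"
  by (rule card_subset_eq) (use assms adjoin_subset[OF assms(1,4,3)] card_adjoin in auto)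

lemma card_psubspace_le:
  fixes V W :: "'a mpoly set"
  assumes V: "fq_subspace V" and W: "fq_subspace W" and "W \<subset> V" and "finite V"
  shows "q * card W \<le> card V"
proof -
  obtain u where u: "u \<in> V" "u \<notin> W"
    using \<open>W \<subset> V\<close> by blast
  have "card (adjoin u W) \<le> card V"
    by (rule card_mono) (use assms u adjoin_subset[OF V] in auto)
  then show ?thesis
    using card_adjoin[OF W u(2)] by simp
qed

text \<open>Outside vectors are adjoined to U one at a time, each multiplying the size by q. With U
  = 0 this produces hyperplanes; with U spanned by w it produces a hyperplane through w.\<close>

lemma ex_intermediate_subspace:
  fixes U V :: "'a mpoly set"
  assumes U: "fq_subspace U" and V: "fq_subspace V" and "U \<subseteq> V"
    and "card U = q ^ j" and cV: "card V = q ^ k" and "j \<le> i" "i \<le> k"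
  shows "\<exists>W\<in>subspaces_card (q ^ i) V. U \<subseteq> W"
  using \<open>j \<le> i\<close> \<open>i \<le> k\<close>
proof (induction i rule: dec_induct)
  case base
  then show ?case
    using assms by (auto simp: subspaces_card_def)
next
  case (step i)
  then obtain W where W: "fq_subspace W" "W \<subseteq> V" "card W = q ^ i" "U \<subseteq> W"
    by (auto simp: subspaces_card_def)
  have "card W < card V"
    using W cV step q_ge_2 by simp
  then obtain u where u: "u \<in> V" "u \<notin> W"
    using W by (metis psubsetI less_irrefl psubset_imp_ex_mem DiffE)
  have "adjoin u W \<in> subspaces_card (q ^ Suc i) V"
    using W u V by (simp add: subspaces_card_def fq_subspace_adjoin adjoin_subset card_adjoin)
  then show ?case
    using W subset_adjoin by blast
qed

lemma ex_adjoin_hyperplane: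
  fixes W :: "'a mpoly set"
  assumes W: "fq_subspace W" "card W = q ^ Suc k"
  obtains H u where "fq_subspace H" "card H = q ^ k" "u \<notin> H" "W = adjoin u H"
proof -
  obtain H where H: "fq_subspace H" "H \<subseteq> W" "card H = q ^ k"
    using ex_intermediate_subspace[OF fq_subspace_zero W(1), of 0 "Suc k" k]
      fq_subspace_0 W by (auto simp: subspaces_card_def)
  have "card H < card W"
    using H W q_ge_2 by simp
  then obtain u where u: "u \<in> W" "u \<notin> H"
    using H by (metis psubsetI less_irrefl psubset_imp_ex_mem DiffE)
  show thesis
    using that[OF H(1,3) u(2)] adjoin_eq[OF W(1) H(1,2) u] H W finite_card_q_pow[OF W(2)] by simp
qed

section \<open>The maps f_W as q-polynomials\<close>

text \<open>Grouping the product by cosets c u + W gives factors f_W(x + c u) = f_W(x) + c f_W(u),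
  and \<open>prod_add_scale\<close> applies. Linearity of f_W is a hypothesis because it is itself
  proved by an induction that uses this formula.\<close>

lemma fW_adjoin:
  fixes W :: "'a mpoly set"
  assumes W: "fq_subspace W" and u: "u \<notin> W" and lin: "fq_linear (fW W)"
  shows "fW (adjoin u W) x = fW W x ^ q - fW W u ^ (q - 1) * fW W x"
proof -
  have "fW (adjoin u W) x = (\<Prod>(c, h)\<in>UNIV \<times> W. x + (const c * u + h))"
    unfolding fW_def adjoin_def
    by (subst prod.reindex[OF inj_on_adjoin[OF W u]]) (simp add: case_prod_beta)
  also have "\<dots> = (\<Prod>c\<in>UNIV. fW W (x + const c * u))"
    by (simp add: fW_def prod.cartesian_product add.assoc)
  also have "\<dots> = (\<Prod>c\<in>UNIV. fW W x + const c * fW W u)"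
    by (simp add: fq_linear_add[OF lin] fq_linear_scale[OF lin])
  finally show ?thesis
    by (simp add: prod_add_scale)
qed

lemma fq_linear_pow: "fq_linear (\<lambda>x :: 'a mpoly. x ^ (q ^ k))"
  by (simp add: fq_linear_def add_pow_q_pow power_mult_distrib const_pow_q_pow)

lemma fq_linear_pow_comp: "fq_linear (\<lambda>x :: 'a mpoly. f x ^ (q ^ k))" if "fq_linear f"
  using that by (simp add: fq_linear_def add_pow_q_pow power_mult_distrib const_pow_q_pow)

lemma fq_linear_q_polynomial:
  "fq_linear (\<lambda>x :: 'a mpoly. x ^ (q ^ k) + (\<Sum>j<k. c j * x ^ (q ^ j)))"
  by (simp add: fq_linear_def add_pow_q_pow power_mult_distrib const_pow_q_pow
      sum.distrib sum_distrib_left algebra_simps)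

text \<open>By \<open>fW_adjoin\<close>, adjoining a vector sends f_H to f_H^q - a f_H, and both
  terms are again combinations of q-powers of x. The explicit form yields linearity and, later,
  column operations on alternants.\<close>

lemma fW_q_polynomial:
  fixes W :: "'a mpoly set"
  assumes "fq_subspace W" "card W = q ^ k"
  shows "\<exists>c. fW W = (\<lambda>x. x ^ (q ^ k) + (\<Sum>j<k. c j * x ^ (q ^ j)))"
  using assms
proof (induction k arbitrary: W)
  case 0
  then have "W = {0}"
    using fq_subspace_0[of W] by (auto simp: card_1_singleton_iff)
  then show ?case
    by (simp add: fW_zero_space fun_eq_iff)
next
  case (Suc k)
  obtain H u where H: "fq_subspace H" "card H = q ^ k" and u: "u \<notin> H" and W: "W = adjoin u H"
    using ex_adjoin_hyperplane[OF Suc.prems] .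
  obtain c where c: "fW H = (\<lambda>x. x ^ (q ^ k) + (\<Sum>j<k. c j * x ^ (q ^ j)))"
    using Suc.IH[OF H] by blast
  define a where "a = fW H u ^ (q - 1)"
  have lin: "fq_linear (fW H)"
    unfolding c by (rule fq_linear_q_polynomial)
  \<comment> \<open>The first term is the coefficient of f_H^q, whose indices are shifted by one;
    the second is that of a f_H, where index k carries the leading coefficient 1.\<close>
  define d where "d j = (if j = 0 then 0 else c (j - 1) ^ q) - a * (if j = k then 1 else c j)" for j
  have "fW W x = x ^ (q ^ Suc k) + (\<Sum>j<Suc k. d j * x ^ (q ^ j))" for x
  proof -
    have "(\<Sum>j<Suc k. d j * x ^ (q ^ j)) =
        (\<Sum>j<Suc k. (if j = 0 then 0 else c (j - 1) ^ q) * x ^ (q ^ j))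
        - (\<Sum>j<Suc k. a * (if j = k then 1 else c j) * x ^ (q ^ j))"
      by (simp only: d_def left_diff_distrib sum_subtractf)
    also have "(\<Sum>j<Suc k. (if j = 0 then 0 else c (j - 1) ^ q) * x ^ (q ^ j))
        = (\<Sum>j<k. c j * x ^ (q ^ j)) ^ q"
      using sum_pow_q_pow[of "\<lambda>j. c j * x ^ (q ^ j)" "{..<k}" 1]
      by (subst sum.lessThan_Suc_shift) (simp add: power_mult_distrib power_mult[symmetric] mult.commute)
    also have "(\<Sum>j<Suc k. a * (if j = k then 1 else c j) * x ^ (q ^ j)) = a * fW H x"
      by (simp add: c distrib_left sum_distrib_left mult.assoc)
    finally have "x ^ (q ^ Suc k) + (\<Sum>j<Suc k. d j * x ^ (q ^ j))
        = x ^ (q ^ Suc k) + (\<Sum>j<k. c j * x ^ (q ^ j)) ^ q - a * fW H x"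
      by simp
    also have "x ^ (q ^ Suc k) + (\<Sum>j<k. c j * x ^ (q ^ j)) ^ q = fW H x ^ q"
      by (simp add: c add_pow_q power_mult[symmetric] mult.commute)
    also have "fW H x ^ q - a * fW H x = fW W x"
      using fW_adjoin[OF H(1) u lin] W by (simp add: a_def)
    finally show ?thesis ..
  qed
  then show ?case by blast
qed

lemma fq_linear_fW: "fq_linear (fW W)" if "fq_subspace W" "card W = q ^ k" for W :: "'a mpoly set"
  using fW_q_polynomial[OF that] fq_linear_q_polynomial by auto

end

section \<open>Summing f_H over the hyperplanes H\<close>

context finite_field_mpoly
begin

text \<open>A hyperplane K of V other than V' meets V' in a hyperplane H of V', and K = H + <u + x>
  with x in V' unique modulo H. As \<open>e H\<close> spans V' modulo H, exactly one x of the form c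
  e(H) occurs. The choice of \<open>e\<close> stays free so that it can be adapted to a given
  vector.\<close>

lemma subspaces_card_extension:
  fixes V V' :: "'a mpoly set"
  assumes V: "fq_subspace V" "card V = q ^ Suc (Suc n)"
    and V': "fq_subspace V'" "V' \<subseteq> V" "card V' = q ^ Suc n"
    and u: "u \<in> V" "u \<notin> V'"
    and e: "\<And>H. H \<in> subspaces_card (q ^ n) V' \<Longrightarrow> e H \<in> V' - H"
  shows "bij_betw (\<lambda>(H, c). adjoin (u + const c * e H) H)
      (subspaces_card (q ^ n) V' \<times> UNIV) (subspaces_card (q ^ Suc n) V - {V'})"
    (is "bij_betw ?g (?S \<times> UNIV) (?T - {V'})")
proof -
  have finV: "finite V" and finV': "finite V'"
    using V V' finite_card_q_pow by blast+
  have shifted: "u + x \<notin> V'" if "x \<in> V'" for x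
    using fq_subspace_diff[OF V'(1) _ that] u by force
  \<comment> \<open>H is recovered as the intersection with V', because the adjoined vector lies
    outside V'.\<close>
  have Int: "adjoin (u + const c * e H) H \<inter> V' = H" if "H \<in> ?S" for H c
  proof
    have H: "fq_subspace H" "H \<subseteq> V'" and eH: "e H \<in> V'"
      using that e by (auto simp: subspaces_card_def)
    show "adjoin (u + const c * e H) H \<inter> V' \<subseteq> H"
    proof
      fix x assume "x \<in> adjoin (u + const c * e H) H \<inter> V'"
      then obtain d h where x: "x = const d * (u + const c * e H) + h" "h \<in> H" "x \<in> V'"
        by (auto simp: mem_adjoin)
      have "const d * (u + const c * e H) \<in> V'"
        using fq_subspace_diff[OF V'(1) x(3), of h] x H by auto
      then have "d = 0"
        using fq_subspace_scaleD[OF V'(1)] shifted fq_subspace_scale[OF V'(1) eH] by blast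
      then show "x \<in> H"
        using x by simp
    qed
    show "H \<subseteq> adjoin (u + const c * e H) H \<inter> V'"
      using H subset_adjoin by auto
  qed
  have inj: "inj_on ?g (?S \<times> UNIV)"
  proof (rule inj_onI, clarsimp)
    fix H c H' c'
    assume S: "H \<in> ?S" "H' \<in> ?S"
      and eq: "adjoin (u + const c * e H) H = adjoin (u + const c' * e H') H'"
    have H': "H' = H"
      using Int[OF S(1), of c] Int[OF S(2), of c'] eq by simp
    let ?A = "adjoin (u + const c * e H) H"
    have H: "fq_subspace H" and eH: "e H \<in> V'" "e H \<notin> H"
      using S e by (auto simp: subspaces_card_def)
    have "u + const c * e H \<in> ?A" "u + const c' * e H \<in> ?A"
      using generator_in_adjoin[OF H] eq H' by auto
    \<comment> \<open>Two such generators of the same space differ by (c - c') e(H), which lies in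
      V' and hence, by \<open>Int\<close>, in H.\<close>
    then have "(u + const c * e H) - (u + const c' * e H) \<in> ?A"
      by (rule fq_subspace_diff[OF fq_subspace_adjoin[OF H]])
    moreover have "(u + const c * e H) - (u + const c' * e H) = const (c - c') * e H"
      using const_add[of "c - c'" c'] by (simp add: algebra_simps)
    ultimately have "const (c - c') * e H \<in> H"
      using Int[OF S(1), of c] fq_subspace_scale[OF V'(1) eH(1)] by auto
    then have "c = c'"
      using fq_subspace_scaleD[OF H] eH by force
    then show "H = H' \<and> c = c'"
      using H' by simp
  qed
  have into: "?g ` (?S \<times> UNIV) \<subseteq> ?T - {V'}"
  proof
    fix K assume "K \<in> ?g ` (?S \<times> UNIV)"
    then obtain H c where S: "H \<in> ?S" and K: "K = adjoin (u + const c * e H) H"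
      by auto
    then have H: "fq_subspace H" "H \<subseteq> V'" "card H = q ^ n" and eH: "e H \<in> V'"
      using e by (auto simp: subspaces_card_def)
    let ?w = "u + const c * e H"
    have w: "?w \<notin> V'"
      using shifted fq_subspace_scale[OF V'(1) eH] by blast
    have "?w \<in> V"
      using eH V' u V(1) by (auto intro!: fq_subspace_add fq_subspace_scale)
    moreover have "?w \<notin> H"
      using w H by blast
    ultimately show "K \<in> ?T - {V'}"
      unfolding K using H w V V' generator_in_adjoin[OF H(1), of ?w] adjoin_subset[OF V(1), of ?w H]
      by (auto simp: subspaces_card_def fq_subspace_adjoin card_adjoin)
  qed
  have onto: "?T - {V'} \<subseteq> ?g ` (?S \<times> UNIV)"
  proof
    fix K assume "K \<in> ?T - {V'}"
    then have K: "fq_subspace K" "K \<subseteq> V" "card K = q ^ Suc n" "K \<noteq> V'"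
      by (auto simp: subspaces_card_def)
    have "\<not> K \<subseteq> V'"
      using K V' finV' card_subset_eq by metis
    then obtain x where x: "x \<in> K" "x \<notin> V'" by blast
    have "x \<in> adjoin u V'"
      using adjoin_eq[OF V(1) V'(1,2) u] V V' finV x K by auto
    then obtain d v where dv: "x = const d * u + v" "v \<in> V'"
      by (auto simp: mem_adjoin)
    have d: "d \<noteq> 0"
      using dv x by auto
    \<comment> \<open>Rescaling x normalises its component along u to 1.\<close>
    define y where "y = const (inverse d) * x"
    define v' where "v' = const (inverse d) * v"
    have v': "v' \<in> V'"
      unfolding v'_def by (rule fq_subspace_scale[OF V'(1) dv(2)])
    have y: "y = u + v'"
      using d by (simp add: y_def v'_def dv distrib_left flip: mult.assoc const_mult)
    have yK: "y \<in> K"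
      unfolding y_def by (rule fq_subspace_scale[OF K(1) x(1)])
    have yV': "y \<notin> V'"
      using shifted[OF v'] y by simp
    define H where "H = K \<inter> V'"
    have H: "fq_subspace H" "H \<subseteq> V'"
      unfolding H_def using fq_subspace_Int K V' by auto
    have "K \<subseteq> adjoin y H"
    proof
      fix k assume k: "k \<in> K"
      have "k \<in> adjoin y V'"
        using adjoin_eq[OF V(1) V'(1,2), of y] V V' finV k K yK yV' by auto
      then obtain b z where bz: "k = const b * y + z" "z \<in> V'"
        by (auto simp: mem_adjoin)
      have "z = k - const b * y"
        using bz by simp
      then have "z \<in> K"
        using fq_subspace_diff[OF K(1) k fq_subspace_scale[OF K(1) yK]] by simp
      then show "k \<in> adjoin y H"
        using bz by (auto simp: mem_adjoin H_def)
    qed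
    moreover have "adjoin y H \<subseteq> K"
      by (rule adjoin_subset[OF K(1) yK]) (auto simp: H_def)
    ultimately have KH: "K = adjoin y H" by simp
    have "y \<notin> H"
      using yV' by (simp add: H_def)
    \<comment> \<open>K arises from H by adjoining one outside vector, which forces H to have q^n
      elements.\<close>
    then have "q * card H = q ^ Suc n"
      using KH card_adjoin[OF H(1)] K by metis
    then have S: "H \<in> ?S"
      using H q_ge_2 by (simp add: subspaces_card_def)
    have "v' \<in> adjoin (e H) H"
      using adjoin_eq[OF V'(1) H, of "e H"] S e[OF S] V' finV' v' by (simp add: subspaces_card_def)
    then obtain c h where ch: "v' = const c * e H + h" "h \<in> H"
      by (auto simp: mem_adjoin)
    \<comment> \<open>Changing y by an element of H turns it into the prescribed generator without
      changing K.\<close>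
    have "u + const c * e H = y - h"
      using ch y by simp
    then have w: "u + const c * e H \<in> K" "u + const c * e H \<notin> H"
      using fq_subspace_diff[OF K(1) yK, of h] ch shifted[OF fq_subspace_scale[OF V'(1)], of "e H" c] e[OF S]
      by (auto simp: H_def)
    have "adjoin (u + const c * e H) H = K"
      using adjoin_eq[OF K(1) H(1) _ w] S K finite_card_q_pow[OF K(3)]
      by (auto simp: subspaces_card_def H_def)
    then show "K \<in> ?g ` (?S \<times> UNIV)"
      using S by force
  qed
  show ?thesis
    using inj into onto by (auto simp: bij_betw_def)
qed

lemma sum_fW_hyperplanes:
  fixes V :: "'a mpoly set"
  assumes "fq_subspace V" "card V = q ^ Suc n" "w \<in> V"
  shows "(\<Sum>H\<in>subspaces_card (q ^ n) V. fW H w) = w ^ (q ^ n)"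
  using assms
proof (induction n arbitrary: V)
  case 0
  have "subspaces_card 1 V = {{0}}"
    using 0 fq_subspace_zero fq_subspace_0
    by (fastforce simp: subspaces_card_def card_1_singleton_iff)
  then show ?case
    by (simp add: fW_zero_space)
next
  case (Suc n)
  note V = Suc.prems(1,2)
  have finV: "finite V"
    using V finite_card_q_pow by blast
  \<comment> \<open>U is the span of w; its dimension j is 0 when w = 0 and 1 otherwise.\<close>
  obtain U j where U: "fq_subspace U" "U \<subseteq> V" "w \<in> U" "card U = q ^ j" "j \<le> 1"
  proof (cases "w = 0")
    case True
    then show ?thesis
      using that[of "{0}" 0] fq_subspace_zero fq_subspace_0[OF V(1)] by (metis card_1_singleton_iff
          empty_subsetI insert_subset le0 One_nat_def power_0 singletonI)
  next
    case False
    then have "card (adjoin w {0}) = q ^ 1"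
      by (simp add: card_adjoin fq_subspace_zero)
    then show ?thesis
      using that[of "adjoin w {0}" 1] fq_subspace_adjoin[OF fq_subspace_zero]
        generator_in_adjoin[OF fq_subspace_zero]
        adjoin_subset[OF V(1) Suc.prems(3), of "{0}"] fq_subspace_0[OF V(1)] by blast
  qed
  then obtain V' where V': "fq_subspace V'" "V' \<subseteq> V" "card V' = q ^ Suc n" and wV': "w \<in> V'"
    using ex_intermediate_subspace[OF U(1) V(1) U(2,4) V(2), of "Suc n"] U(3,5)
    by (auto simp: subspaces_card_def)
  have "card V' < card V"
    using V V' q_ge_2 by simp
  then obtain u where u: "u \<in> V" "u \<notin> V'"
    using V' by (metis psubsetI less_irrefl psubset_imp_ex_mem DiffE)
  let ?S = "subspaces_card (q ^ n) V'" and ?T = "subspaces_card (q ^ Suc n) V"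
  \<comment> \<open>Taking e(H) = w whenever w is outside H makes the factor f_H(e(H))^(q-1) combine
    with f_H(w) to f_H(w)^q.\<close>
  have "\<exists>e. e \<in> V' - H \<and> (w \<notin> H \<longrightarrow> e = w)" if "H \<in> ?S" for H
  proof (cases "w \<in> H")
    case True
    have "card H < card V'"
      using that V' q_ge_2 by (simp add: subspaces_card_def)
    then show ?thesis
      using True that by (metis (no_types, lifting) mem_Collect_eq psubsetI less_irrefl psubset_imp_ex_mem
          subspaces_card_def)
  qed (use wV' in auto)
  then obtain e where e: "\<And>H. H \<in> ?S \<Longrightarrow> e H \<in> V' - H"
    and ew: "\<And>H. H \<in> ?S \<Longrightarrow> w \<notin> H \<Longrightarrow> e H = w"
    by metis
  have fib: "(\<Sum>c\<in>UNIV. fW (adjoin (u + const c * e H) H) w) = fW H w ^ q" if S: "H \<in> ?S" for H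
  proof -
    have H: "fq_subspace H" "card H = q ^ n" "H \<subseteq> V'"
      using S by (auto simp: subspaces_card_def)
    have finH: "finite H"
      using H finite_card_q_pow by blast
    have lin: "fq_linear (fW H)"
      by (rule fq_linear_fW[OF H(1,2)])
    define a where "a = fW H w"
    define \<epsilon> where "\<epsilon> = fW H (e H)"
    have nin: "u + const c * e H \<notin> H" for c
    proof
      assume "u + const c * e H \<in> H"
      then have "(u + const c * e H) - const c * e H \<in> V'"
        using e[OF S] H by (intro fq_subspace_diff[OF V'(1)] fq_subspace_scale[OF V'(1)]) auto
      then show False
        using u by simp
    qed
    have "(\<Sum>c\<in>UNIV. fW (adjoin (u + const c * e H) H) w)
        = (\<Sum>c\<in>(UNIV :: 'a set). a ^ q - (fW H u + const c * \<epsilon>) ^ (q - 1) * a)"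
      by (simp add: fW_adjoin[OF H(1) nin lin] a_def \<epsilon>_def fq_linear_add[OF lin] fq_linear_scale[OF lin])
    \<comment> \<open>The term a^q does not depend on c, so summing it over the field gives q a^q =
      0.\<close>
    also have "\<dots> = of_nat q * a ^ q - (\<Sum>c\<in>(UNIV :: 'a set). (fW H u + const c * \<epsilon>) ^ (q - 1)) * a"
      by (simp only: sum_subtractf sum_distrib_right[symmetric] sum_constant q_eq[symmetric])
    also have "\<dots> = \<epsilon> ^ (q - 1) * a"
      by (simp only: sum_add_scale_pow of_nat_q) simp
    also have "\<dots> = a ^ q"
    proof (cases "w \<in> H")
      case True
      then have "a = 0"
        unfolding a_def by (rule fW_eq_0[OF H(1) finH])
      then show ?thesis
        using q_ge_2 by simp
    next
      case False
      then have "\<epsilon> ^ (q - 1) * a = a ^ Suc (q - 1)"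
        using ew[OF S] by (simp add: a_def \<epsilon>_def mult.commute)
      then show ?thesis
        using q_ge_2 by simp
    qed
    finally show ?thesis
      by (simp add: a_def)
  qed
  have "V' \<in> ?T"
    using V' by (simp add: subspaces_card_def)
  then have "(\<Sum>K\<in>?T. fW K w) = fW V' w + (\<Sum>K\<in>?T - {V'}. fW K w)"
    by (rule sum.remove[OF finite_subspaces_card[OF finV]])
  also have "fW V' w = 0"
    using V' finV finite_subset wV' by (intro fW_eq_0) auto
  also have "(\<Sum>K\<in>?T - {V'}. fW K w)
      = (\<Sum>(H, c)\<in>?S \<times> UNIV. fW (adjoin (u + const c * e H) H) w)"
    using sum.reindex_bij_betw[OF subspaces_card_extension[OF V V' u e], of "\<lambda>K. fW K w"]
    by (simp add: case_prod_beta)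
  also have "\<dots> = (\<Sum>H\<in>?S. \<Sum>c\<in>UNIV. fW (adjoin (u + const c * e H) H) w)"
    by (simp add: sum.cartesian_product)
  also have "\<dots> = (\<Sum>H\<in>?S. fW H w ^ q)"
    by (rule sum.cong) (simp_all add: fib)
  also have "\<dots> = (\<Sum>H\<in>?S. fW H w) ^ q"
    using sum_pow_q_pow[of "\<lambda>H. fW H w" ?S 1] by simp
  also have "\<dots> = w ^ (q ^ Suc n)"
    using Suc.IH[OF V'(1,3) wV'] by (simp add: power_mult[symmetric] mult.commute)
  finally show ?case by simp
qed

end

section \<open>Alternants\<close>

text \<open>Lists may be dependent; independence is expressed by
  \<open>card (lspan us) = q ^ length us\<close>.\<close>

definition lspan :: "'a::field mpoly list \<Rightarrow> 'a mpoly set" where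
  "lspan us = {(\<Sum>j<length us. const (c j) * us ! j) | c. True}"

lemma lspan_Nil: "lspan [] = {0}"
  by (simp add: lspan_def)

lemma lspan_Cons: "lspan (u # us) = adjoin u (lspan us)"
proof (rule equalityI; rule subsetI)
  fix x assume "x \<in> lspan (u # us)"
  then obtain c where "x = (\<Sum>j<Suc (length us). const (c j) * (u # us) ! j)"
    by (auto simp: lspan_def)
  then have "x = const (c 0) * u + (\<Sum>j<length us. const (c (Suc j)) * us ! j)"
    by (simp add: sum.lessThan_Suc_shift del: sum.lessThan_Suc)
  moreover have "(\<Sum>j<length us. const (c (Suc j)) * us ! j) \<in> lspan us"
    unfolding lspan_def by (intro CollectI exI[of _ "\<lambda>j. c (Suc j)"]) simp
  ultimately show "x \<in> adjoin u (lspan us)"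
    unfolding mem_adjoin by blast
next
  fix x assume "x \<in> adjoin u (lspan us)"
  then obtain c d where "x = const c * u + (\<Sum>j<length us. const (d j) * us ! j)"
    by (auto simp: mem_adjoin lspan_def)
  then have "x = (\<Sum>j<length (u # us). const (case_nat c d j) * (u # us) ! j)"
    by (simp add: sum.lessThan_Suc_shift del: sum.lessThan_Suc)
  then show "x \<in> lspan (u # us)"
    unfolding lspan_def by blast
qed

lemma fq_subspace_lspan: "fq_subspace (lspan us)"
  by (induction us) (simp_all add: lspan_Nil lspan_Cons fq_subspace_zero fq_subspace_adjoin)

lemma nth_in_lspan: "i < length us \<Longrightarrow> us ! i \<in> lspan us"
proof (induction us arbitrary: i)
  case (Cons u us)
  then show ?case
    using subset_adjoin[of "lspan us" u] generator_in_adjoin[OF fq_subspace_lspan, of u us]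
    by (cases i) (auto simp: lspan_Cons)
qed simp

section \<open>Alternants with arbitrary column functions\<close>

text \<open>Columns are arbitrary functions so that one of them can be replaced by f_H. In
  \<open>case_nat g \<phi>\<close> the function g is column 0 and the columns of
  \<open>\<phi>\<close> follow.\<close>

definition alt :: "nat \<Rightarrow> (nat \<Rightarrow> 'a \<Rightarrow> 'b::comm_ring_1) \<Rightarrow> 'a list \<Rightarrow> 'b" where
  "alt n \<phi> ws = det (mat n n (\<lambda>(i, j). \<phi> j (ws ! i)))"

lemma alt_cong:
  assumes "\<And>i j. i < n \<Longrightarrow> j < n \<Longrightarrow> \<phi> j (ws ! i) = \<psi> j (ws ! i)"
  shows "alt n \<phi> ws = alt n \<psi> ws"
proof -
  have "mat n n (\<lambda>(i, j). \<phi> j (ws ! i)) = mat n n (\<lambda>(i, j). \<psi> j (ws ! i))"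
    by (rule eq_matI) (auto simp: assms)
  then show ?thesis by (simp add: alt_def)
qed

text \<open>Laplace expansion. The minors do not involve g, so the alternant is linear in its first
  column.\<close>

lemma alt_expand_first_column:
  "alt (Suc n) (case_nat g \<phi>) ws = (\<Sum>i<Suc n. g (ws ! i) *
     ((- 1) ^ i * det (mat n n (\<lambda>(r, j). \<phi> j (ws ! (if r < i then r else Suc r))))))"
proof -
  let ?A = "mat (Suc n) (Suc n) (\<lambda>(i, j). case_nat g \<phi> j (ws ! i))"
  have "mat_delete ?A i 0 = mat n n (\<lambda>(r, j). \<phi> j (ws ! (if r < i then r else Suc r)))"
    if "i < Suc n" for i
    by (rule eq_matI) (use that in \<open>auto simp: mat_delete_def\<close>)
  then show ?thesis
    unfolding alt_def
    by (subst laplace_expansion_column[of _ "Suc n" 0]) (auto simp: cofactor_def intro!: sum.cong)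
qed

text \<open>The coefficients \<open>k\<close> serve the lower terms of a q-polynomial; for the sum
  over hyperplanes they are all 1.\<close>

lemma alt_first_column_sum:
  "alt (Suc n) (case_nat (\<lambda>x. \<Sum>a\<in>A. k a * g a x) \<phi>) ws
     = (\<Sum>a\<in>A. k a * alt (Suc n) (case_nat (g a) \<phi>) ws)"
  unfolding alt_expand_first_column sum_distrib_left sum_distrib_right
  by (subst sum.swap) (simp add: mult.assoc)

lemma alt_first_column_add:
  "alt (Suc n) (case_nat (\<lambda>x. f x + g x) \<phi>) ws
     = alt (Suc n) (case_nat f \<phi>) ws + alt (Suc n) (case_nat g \<phi>) ws"
  unfolding alt_expand_first_column by (simp only: distrib_right sum.distrib)

lemma alt_first_column_unit:
  assumes "\<And>i. i < n \<Longrightarrow> g (hs ! i) = 0"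
  shows "alt (Suc n) (case_nat g \<phi>) (v # hs) = g v * alt n \<phi> hs"
  unfolding alt_expand_first_column
  by (simp add: sum.lessThan_Suc_shift assms alt_def del: sum.lessThan_Suc)

lemma alt_repeated_column:
  assumes "j < n"
  shows "alt (Suc n) (case_nat (\<phi> j) \<phi>) ws = 0"
  unfolding alt_def
  by (rule det_identical_columns[of _ "Suc n" 0 "Suc j"]) (use assms in \<open>auto intro!: eq_vecI\<close>)

text \<open>The matrix for \<open>ws\<close> is P times the matrix for \<open>us\<close>, where P
  has constant entries and so commutes with linear maps. The factor d = det P is the same for all
  \<open>\<phi>\<close>, which lets it pass from the alternant of lambda + delta to that of
  delta.\<close>

lemma alt_basis_change:
  assumes "length us = n" and ws: "\<And>i. i < n \<Longrightarrow> ws ! i \<in> lspan us"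
  obtains d where "\<And>\<phi>. (\<And>j. j < n \<Longrightarrow> fq_linear (\<phi> j)) \<Longrightarrow> alt n \<phi> ws = d * alt n \<phi> us"
proof -
  have "\<exists>p. ws ! i = (\<Sum>k<n. const (p k) * us ! k)" if "i < n" for i
    using ws[OF that] assms(1) by (auto simp: lspan_def)
  then obtain p where p: "\<And>i. i < n \<Longrightarrow> ws ! i = (\<Sum>k<n. const (p i k) * us ! k)"
    by metis
  define P where "P = mat n n (\<lambda>(i, k). const (p i k))"
  have "alt n \<phi> ws = det P * alt n \<phi> us" if lin: "\<And>j. j < n \<Longrightarrow> fq_linear (\<phi> j)" for \<phi>
  proof -
    let ?M = "\<lambda>xs. mat n n (\<lambda>(i, j). \<phi> j (xs ! i))"
    have "?M ws = P * ?M us"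
    proof (rule eq_matI)
      fix i j assume "i < dim_row (P * ?M us)" "j < dim_col (P * ?M us)"
      then have ij: "i < n" "j < n"
        by (auto simp: P_def)
      have "\<phi> j (ws ! i) = (\<Sum>k<n. const (p i k) * \<phi> j (us ! k))"
        by (simp add: p[OF ij(1)] fq_linear_sum[OF lin[OF ij(2)]] fq_linear_scale[OF lin[OF ij(2)]])
      then show "?M ws $$ (i, j) = (P * ?M us) $$ (i, j)"
        using ij by (simp add: P_def scalar_prod_def atLeast0LessThan)
    qed (auto simp: P_def)
    then show ?thesis
      unfolding alt_def by (simp add: det_mult[of _ n] P_def)
  qed
  then show thesis using that by blast
qed

lemma delta_Suc: "delta (Suc n) = n # delta n"
  unfolding delta_def by (simp add: upt_conv_Cons map_Suc_upt[symmetric] del: upt_Suc)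

lemma length_delta [simp]: "length (delta n) = n"
  by (simp add: delta_def)

lemma Aalt_eq_alt: "Aalt q ws \<alpha> = alt (length ws) (\<lambda>j x. x ^ (q ^ (\<alpha> ! j))) ws"
  by (simp add: Aalt_def alt_def)

lemma Aalt_Cons:
  assumes "length ws = Suc n"
  shows "Aalt q ws (a # \<beta>) = alt (Suc n) (case_nat (\<lambda>x. x ^ (q ^ a)) (\<lambda>j x. x ^ (q ^ (\<beta> ! j)))) ws"
  unfolding Aalt_eq_alt assms by (rule alt_cong) (auto split: nat.split)

context finite_field_mpoly
begin

section \<open>Independent lists and the Moore determinant\<close>

lemma card_lspan_le: "card (lspan us :: 'a mpoly set) \<le> q ^ length us"
proof (induction us)
  case (Cons u us)
  show ?case
  proof (cases "u \<in> lspan us")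
    case True
    then have "lspan (u # us) = lspan us"
      using adjoin_subset[OF fq_subspace_lspan True subset_refl] subset_adjoin
      by (auto simp: lspan_Cons)
    then show ?thesis
      using Cons q_ge_2 by (simp add: le_trans[OF Cons])
  next
    case False
    then show ?thesis
      using Cons by (simp add: lspan_Cons card_adjoin fq_subspace_lspan)
  qed
qed (simp add: lspan_Nil)

text \<open>If v were in the span of \<open>hs\<close>, the whole span would be too small by
  \<open>card_lspan_le\<close>.\<close>

lemma card_lspan_Cons:
  fixes v :: "'a mpoly"
  assumes "card (lspan (v # hs)) = q ^ Suc (length hs)"
  shows "v \<notin> lspan hs" "card (lspan hs) = q ^ length hs"
proof -
  show v: "v \<notin> lspan hs"
  proof
    assume v: "v \<in> lspan hs"
    have "lspan (v # hs) = lspan hs"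
      using adjoin_subset[OF fq_subspace_lspan v subset_refl] subset_adjoin
      by (auto simp: lspan_Cons)
    then have "q ^ Suc (length hs) \<le> q ^ length hs"
      using assms card_lspan_le[of hs] by simp
    then show False
      using q_ge_2 by simp
  qed
  show "card (lspan hs) = q ^ length hs"
    using assms q_ge_2 by (simp add: lspan_Cons card_adjoin[OF fq_subspace_lspan v])
qed

lemma ex_lspan:
  fixes W :: "'a mpoly set"
  assumes "fq_subspace W" "card W = q ^ k"
  shows "\<exists>hs. length hs = k \<and> lspan hs = W"
  using assms
proof (induction k arbitrary: W)
  case 0
  then have "W = {0}"
    using fq_subspace_0[of W] by (auto simp: card_1_singleton_iff)
  then show ?case
    by (simp add: lspan_Nil)
next
  case (Suc k)
  obtain H u where H: "fq_subspace H" "card H = q ^ k" and W: "W = adjoin u H"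
    using ex_adjoin_hyperplane[OF Suc.prems] .
  obtain hs where "length hs = k" "lspan hs = H"
    using Suc.IH[OF H] by blast
  then show ?case
    using W by (intro exI[of _ "u # hs"]) (simp add: lspan_Cons)
qed

text \<open>Moore's recursion: the lower q-powers in f_H are exactly the remaining columns, so the
  leading column may be replaced by f_H, which vanishes on every row except that of v.\<close>

lemma Aalt_delta_Cons:
  fixes v :: "'a mpoly"
  assumes card: "card (lspan hs) = q ^ length hs"
  shows "Aalt q (v # hs) (delta (Suc (length hs))) = fW (lspan hs) v * Aalt q hs (delta (length hs))"
proof -
  let ?n = "length hs" and ?H = "lspan hs"
  let ?\<phi> = "\<lambda>j (x :: 'a mpoly). x ^ (q ^ (delta ?n ! j))"
  obtain c where c: "fW ?H = (\<lambda>x. x ^ (q ^ ?n) + (\<Sum>j<?n. c j * x ^ (q ^ j)))"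
    using fW_q_polynomial[OF fq_subspace_lspan card] by blast
  have "alt (Suc ?n) (case_nat (\<lambda>x. x ^ (q ^ j)) ?\<phi>) (v # hs) = 0" if "j < ?n" for j
  proof -
    have "?n - 1 - j < ?n"
      using that by simp
    \<comment> \<open>The exponents in \<open>delta\<close> decrease, so x^(q^j) sits at position
      n-1-j.\<close>
    then have "delta ?n ! (?n - 1 - j) = j"
      using that by (simp add: delta_def del: diff_less)
    then show ?thesis
      using alt_repeated_column[of "?n - 1 - j" ?n ?\<phi> "v # hs"] that by simp
  qed
  then have lower: "alt (Suc ?n) (case_nat (\<lambda>x. \<Sum>j<?n. c j * x ^ (q ^ j)) ?\<phi>) (v # hs) = 0"
    by (simp add: alt_first_column_sum)
  have "Aalt q (v # hs) (delta (Suc ?n)) = alt (Suc ?n) (case_nat (\<lambda>x. x ^ (q ^ ?n)) ?\<phi>) (v # hs)"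
    by (simp add: delta_Suc Aalt_Cons)
  also have "\<dots> = alt (Suc ?n) (case_nat (fW ?H) ?\<phi>) (v # hs)"
    by (simp add: c alt_first_column_add lower)
  also have "\<dots> = fW ?H v * alt ?n ?\<phi> hs"
    by (rule alt_first_column_unit)
       (simp add: fW_eq_0 fq_subspace_lspan finite_card_q_pow[OF card] nth_in_lspan)
  also have "alt ?n ?\<phi> hs = Aalt q hs (delta ?n)"
    by (simp add: Aalt_eq_alt)
  finally show ?thesis .
qed

text \<open>By the recursion this is a product of values f_H(v) with v outside H. It makes the
  quotient defining S_lambda unique.\<close>

lemma Aalt_delta_neq_0:
  fixes ws :: "'a mpoly list"
  assumes "card (lspan ws) = q ^ length ws"
  shows "Aalt q ws (delta (length ws)) \<noteq> 0"
  using assms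
proof (induction ws)
  case Nil
  then show ?case
    by (simp add: Aalt_def)
next
  case (Cons v hs)
  then have "v \<notin> lspan hs" "card (lspan hs) = q ^ length hs"
    using card_lspan_Cons[of v hs] by simp_all
  then show ?case
    using Cons.IH Aalt_delta_Cons[of hs v] fW_neq_0[OF fq_subspace_lspan finite_card_q_pow]
    by simp
qed

section \<open>Expanding an alternant over hyperplanes\<close>

lemma Aalt_expand_hyperplanes:
  fixes ws :: "'a mpoly list"
  assumes "length ws = Suc n" "card (lspan ws) = q ^ Suc n"
  shows "Aalt q ws ((m + n) # \<beta>) = (\<Sum>H\<in>subspaces_card (q ^ n) (lspan ws).
    alt (Suc n) (case_nat (\<lambda>x. fW H x ^ (q ^ m)) (\<lambda>j x. x ^ (q ^ (\<beta> ! j)))) ws)"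
proof -
  \<comment> \<open>This is the q^m-th power of the hyperplane identity; the factor 1 matches the
    shape of \<open>alt_first_column_sum\<close>.\<close>
  have "x ^ (q ^ (m + n)) = (\<Sum>H\<in>subspaces_card (q ^ n) (lspan ws). 1 * fW H x ^ (q ^ m))"
    if "x \<in> lspan ws" for x
    using sum_fW_hyperplanes[OF fq_subspace_lspan assms(2) that, symmetric]
      sum_pow_q_pow[of "\<lambda>H. fW H x" "subspaces_card (q ^ n) (lspan ws)" m]
    by (simp add: power_add power_mult mult.commute[of "q ^ m"])
  then have "Aalt q ws ((m + n) # \<beta>) = alt (Suc n) (case_nat
      (\<lambda>x. \<Sum>H\<in>subspaces_card (q ^ n) (lspan ws). 1 * fW H x ^ (q ^ m)) (\<lambda>j x. x ^ (q ^ (\<beta> ! j)))) ws"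
    unfolding Aalt_Cons[OF assms(1)]
    by (intro alt_cong) (auto split: nat.split simp: nth_in_lspan assms)
  then show ?thesis
    by (simp only: alt_first_column_sum) simp
qed

text \<open>Here t stands for the quotient of the two alternants of \<open>hs\<close>, kept in
  multiplied form to avoid division. Passing from \<open>ws\<close> to the basis v,
  \<open>hs\<close> costs the same factor d in both alternants.\<close>

lemma alt_hyperplane_term:
  fixes ws :: "'a mpoly list"
  assumes "length ws = Suc n" and hs: "length hs = n" "card (lspan hs) = q ^ n"
    and span: "lspan ws = lspan (v # hs)"
    and t: "Aalt q hs \<beta> = Aalt q hs (delta n) * t"
  shows "alt (Suc n) (case_nat (\<lambda>x. fW (lspan hs) x ^ (q ^ m)) (\<lambda>j x. x ^ (q ^ (\<beta> ! j)))) ws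
     = Aalt q ws (delta (Suc n)) * (fW (lspan hs) v ^ (q ^ m - 1) * t)"
proof -
  let ?H = "lspan hs"
  obtain d where d: "\<And>\<phi>. (\<And>j. j < Suc n \<Longrightarrow> fq_linear (\<phi> j)) \<Longrightarrow>
      alt (Suc n) \<phi> ws = d * alt (Suc n) \<phi> (v # hs)"
    using alt_basis_change[of "v # hs" "Suc n" ws] assms nth_in_lspan[of _ ws] by auto
  have "alt (Suc n) (case_nat (\<lambda>x. fW ?H x ^ (q ^ m)) (\<lambda>j x. x ^ (q ^ (\<beta> ! j)))) ws
      = d * alt (Suc n) (case_nat (\<lambda>x. fW ?H x ^ (q ^ m)) (\<lambda>j x. x ^ (q ^ (\<beta> ! j)))) (v # hs)"
    by (rule d) (auto split: nat.split
        intro: fq_linear_pow fq_linear_pow_comp[OF fq_linear_fW[OF fq_subspace_lspan hs(2)]])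
  also have "\<dots> = d * (fW ?H v ^ (q ^ m) * Aalt q hs \<beta>)"
    using hs q_ge_2 by (subst alt_first_column_unit)
      (simp_all add: fW_eq_0 fq_subspace_lspan finite_card_q_pow[OF hs(2)] nth_in_lspan Aalt_eq_alt)
  \<comment> \<open>One factor f_H(v) is split off; together with d and the Moore determinant of
    \<open>hs\<close> it rebuilds that of \<open>ws\<close>.\<close>
  also have "fW ?H v ^ (q ^ m) = fW ?H v ^ Suc (q ^ m - 1)"
    using q_ge_2 by simp
  also have "d * (fW ?H v ^ Suc (q ^ m - 1) * Aalt q hs \<beta>)
      = d * (fW ?H v * Aalt q hs (delta n)) * (fW ?H v ^ (q ^ m - 1) * t)"
    unfolding t power_Suc by (simp only: ac_simps)
  also have "d * (fW ?H v * Aalt q hs (delta n)) = Aalt q ws (delta (Suc n))"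
    unfolding Aalt_eq_alt[of _ ws] assms(1)
    using Aalt_delta_Cons[of hs v] hs by (subst d) (simp_all add: fq_linear_pow Aalt_eq_alt)
  finally show ?thesis .
qed

end

section \<open>Flags\<close>

lemma complete_flags_nth_0: "Vs \<in> complete_flags n V \<Longrightarrow> Vs ! 0 = V"
  by (simp add: complete_flags_def)

lemma complete_flags_0: "complete_flags 0 {0} = {[{0}]}"
  by (auto simp: complete_flags_def fq_subspace_zero length_Suc_conv)

text \<open>H is only required to be a proper subspace here; that it is a hyperplane follows later
  by counting.\<close>

lemma Cons_in_complete_flags_iff:
  "Vs \<in> complete_flags (Suc n) V \<longleftrightarrow>
    (\<exists>H Vs'. Vs = V # Vs' \<and> fq_subspace V \<and> H \<subset> V \<and> Vs' \<in> complete_flags n H)"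
proof
  assume "Vs \<in> complete_flags (Suc n) V"
  then have len: "length Vs = Suc (Suc n)" and "Vs ! 0 = V" and last: "Vs ! Suc n = {0}"
    and sub: "\<And>i. i \<le> Suc n \<Longrightarrow> fq_subspace (Vs ! i)"
    and dec: "\<And>i. i < Suc n \<Longrightarrow> Vs ! Suc i \<subset> Vs ! i"
    by (auto simp: complete_flags_def)
  then obtain Vs' where Vs: "Vs = V # Vs'"
    by (cases Vs) auto
  \<comment> \<open>The tail must consist of subspaces of its own first member, which follows by
    chaining the inclusions.\<close>
  have anti: "Vs' ! i \<subseteq> Vs' ! 0" if "i \<le> n" for i
    using that
  proof (induction i)
    case (Suc i)
    then show ?case
      using dec[of "Suc i"] Vs by auto
  qed simp
  have "Vs' \<in> complete_flags n (Vs' ! 0)"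
    using len last sub[of "Suc i" for i] dec[of "Suc i" for i] anti Vs
    by (auto simp: complete_flags_def)
  then show "\<exists>H Vs'. Vs = V # Vs' \<and> fq_subspace V \<and> H \<subset> V \<and> Vs' \<in> complete_flags n H"
    using sub[of 0] dec[of 0] Vs by auto
next
  assume "\<exists>H Vs'. Vs = V # Vs' \<and> fq_subspace V \<and> H \<subset> V \<and> Vs' \<in> complete_flags n H"
  then obtain H Vs' where Vs: "Vs = V # Vs'" and V: "fq_subspace V" "H \<subset> V"
    and Vs': "Vs' \<in> complete_flags n H" by blast
  have Vs'_sub: "fq_subspace (Vs' ! i) \<and> Vs' ! i \<subseteq> V" if "i \<le> n" for i
    using Vs' V(2) that by (auto simp: complete_flags_def)
  have "fq_subspace (Vs ! i) \<and> Vs ! i \<subseteq> V" if "i \<le> Suc n" for i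
    using Vs'_sub V(1) Vs that by (cases i) auto
  moreover have "Vs ! Suc i \<subset> Vs ! i" if "i < Suc n" for i
    using Vs' V(2) Vs that by (cases i) (auto simp: complete_flags_def)
  ultimately show "Vs \<in> complete_flags (Suc n) V"
    using Vs Vs' by (simp add: complete_flags_def)
qed

lemma finite_complete_flags: "finite V \<Longrightarrow> finite (complete_flags n V)"
  by (rule finite_subset[OF _ finite_lists_length_eq[of "Pow V" "Suc n"]])
     (force simp: complete_flags_def in_set_conv_nth less_Suc_eq_le)+

section \<open>The span of the variables\<close>

lemma varspan_Suc: "varspan (Suc n) = adjoin (var n) (varspan n)"
proof (rule equalityI; rule subsetI)
  fix x :: "'a mpoly" assume "x \<in> varspan (Suc n)"
  then obtain c where "x = const (c n) * var n + (\<Sum>i<n. const (c i) * var i)"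
    by (auto simp: varspan_def add.commute)
  then show "x \<in> adjoin (var n) (varspan n)"
    unfolding mem_adjoin varspan_def by blast
next
  fix x :: "'a mpoly" assume "x \<in> adjoin (var n) (varspan n)"
  then obtain c d where "x = const c * var n + (\<Sum>i<n. const (d i) * var i)"
    by (auto simp: mem_adjoin varspan_def)
  then have "x = (\<Sum>i<Suc n. const ((d(n := c)) i) * var i)"
    by (simp add: add.commute)
  then show "x \<in> varspan (Suc n)"
    unfolding varspan_def by blast
qed

lemma varspan_eq_lspan: "varspan n = lspan (map var [0..<n])"
  by (simp add: varspan_def lspan_def)

text \<open>The monomial x_n has coefficient 1 on one side and 0 on the other.\<close>

lemma var_notin_varspan: "var n \<notin> (varspan n :: 'a::field mpoly set)"
proof
  assume "var n \<in> (varspan n :: 'a mpoly set)"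
  then obtain c where c: "var n = (\<Sum>i<n. const (c i) * var i :: 'a mpoly)"
    by (auto simp: varspan_def)
  have "Poly_Mapping.lookup (var n :: 'a mpoly) (Poly_Mapping.single n 1)
      = (\<Sum>i<n. Poly_Mapping.lookup (const (c i) * var i) (Poly_Mapping.single n 1))"
    unfolding c by (rule lookup_sum)
  also have "\<dots> = 0"
  proof (rule sum.neutral, rule ballI)
    fix i assume "i \<in> {..<n}"
    then have "Poly_Mapping.single i (1::nat) \<noteq> Poly_Mapping.single n 1"
      by (metis lessThan_iff less_irrefl lookup_single_eq lookup_single_not_eq one_neq_zero)
    then show "Poly_Mapping.lookup (const (c i) * var i) (Poly_Mapping.single n 1) = 0"
      by (simp add: const_def var_def mult_single lookup_single_not_eq)
  qed
  finally show False
    by (simp add: var_def)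
qed

section \<open>Recursion for the sum over flags\<close>

text \<open>The right side of the theorem without its sign, for an arbitrary V so that the induction
  can pass to hyperplanes.\<close>

definition flag_sum :: "nat \<Rightarrow> nat list \<Rightarrow> nat \<Rightarrow> 'a::field mpoly set \<Rightarrow> 'a mpoly" where
  "flag_sum q lam n V = (\<Sum>Vs\<in>complete_flags n V.
     \<Prod>i\<in>{1..n}. prod_nz (quot_sp (Vs ! (i - 1)) (Vs ! i)) ^ ((q ^ (lam ! (i - 1)) - 1) div (q - 1)))"

context finite_field_mpoly
begin

lemma card_varspan: "card (varspan n :: 'a mpoly set) = q ^ n"
  by (induction n)
     (simp_all add: varspan_eq_lspan lspan_Nil fq_subspace_lspan card_adjoin varspan_Suc
       var_notin_varspan[unfolded varspan_eq_lspan] varspan_Suc[unfolded varspan_eq_lspan]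
       del: upt_Suc)

lemma complete_flags_card_ge:
  fixes V :: "'a mpoly set"
  assumes "Vs \<in> complete_flags n V" "finite V"
  shows "q ^ n \<le> card V"
  using assms
proof (induction n arbitrary: V Vs)
  case 0
  then have "fq_subspace V"
    by (auto simp: complete_flags_def)
  then show ?case
    using 0 fq_subspace_0 by (fastforce simp: Suc_le_eq card_gt_0_iff)
next
  case (Suc n)
  then obtain H Vs' where H: "fq_subspace V" "H \<subset> V" "Vs' \<in> complete_flags n H"
    by (auto simp: Cons_in_complete_flags_iff)
  have "fq_subspace H"
    using H by (auto simp: complete_flags_def)
  then have "q * card H \<le> card V"
    using H Suc.prems by (intro card_psubspace_le)
  moreover have "q ^ n \<le> card H"
    using H Suc.prems finite_subset by (intro Suc.IH) auto
  ultimately show ?case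
    by (metis le_trans mult_le_mono2 power_Suc)
qed

text \<open>Strict inclusion bounds the size of H by q^n from above, and the n further steps below H
  bound it by q^n from below.\<close>

lemma complete_flags_Suc:
  fixes V :: "'a mpoly set"
  assumes V: "fq_subspace V" "card V = q ^ Suc n"
  shows "complete_flags (Suc n) V
    = (\<lambda>(H, Vs). V # Vs) ` (SIGMA H:subspaces_card (q ^ n) V. complete_flags n H)"
proof (rule equalityI; rule subsetI)
  have fin: "finite V"
    using V finite_card_q_pow by blast
  fix Vs assume "Vs \<in> complete_flags (Suc n) V"
  then obtain H Vs' where H: "Vs = V # Vs'" "H \<subset> V" "Vs' \<in> complete_flags n H"
    by (auto simp: Cons_in_complete_flags_iff)
  have sub: "fq_subspace H"
    using H by (auto simp: complete_flags_def)
  have "q * card H \<le> q * q ^ n"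
    using card_psubspace_le[OF V(1) sub H(2) fin] V by simp
  moreover have "q ^ n \<le> card H"
    using complete_flags_card_ge[OF H(3)] H fin finite_subset by blast
  ultimately have "H \<in> subspaces_card (q ^ n) V"
    using q_ge_2 sub H by (simp add: subspaces_card_def)
  then show "Vs \<in> (\<lambda>(H, Vs). V # Vs) ` (SIGMA H:subspaces_card (q ^ n) V. complete_flags n H)"
    using H by force
next
  fix Vs assume "Vs \<in> (\<lambda>(H, Vs). V # Vs) ` (SIGMA H:subspaces_card (q ^ n) V. complete_flags n H)"
  then obtain H Vs' where H: "H \<in> subspaces_card (q ^ n) V" "Vs' \<in> complete_flags n H" "Vs = V # Vs'"
    by auto
  have "H \<subset> V"
    using H V q_ge_2 by (auto simp: subspaces_card_def)
  then show "Vs \<in> complete_flags (Suc n) V"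
    using H V by (auto simp: Cons_in_complete_flags_iff)
qed

lemma flag_sum_Suc:
  fixes V :: "'a mpoly set"
  assumes V: "fq_subspace V" "card V = q ^ Suc n"
  shows "flag_sum q (m # lam) (Suc n) V = (\<Sum>H\<in>subspaces_card (q ^ n) V.
     prod_nz (quot_sp V H) ^ ((q ^ m - 1) div (q - 1)) * flag_sum q lam n H)"
proof -
  let ?S = "subspaces_card (q ^ n) V"
  let ?F = "\<lambda>n lam Vs. \<Prod>i\<in>{1..n}. prod_nz (quot_sp (Vs ! (i - 1)) (Vs ! i :: 'a mpoly set))
      ^ ((q ^ (lam ! (i - 1)) - 1) div (q - 1))"
  have fin: "finite V"
    using V finite_card_q_pow by blast
  have finS: "\<forall>H\<in>?S. finite (complete_flags n H)"
    using fin finite_subset by (auto simp: subspaces_card_def intro!: finite_complete_flags)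
  have split: "?F (Suc n) (m # lam) (V # Vs)
      = prod_nz (quot_sp V (Vs ! 0)) ^ ((q ^ m - 1) div (q - 1)) * ?F n lam Vs" for Vs
    unfolding One_nat_def prod.atLeast1_atMost_eq prod.lessThan_Suc_shift by simp
  \<comment> \<open>H can be read off as the first member of the remaining flag.\<close>
  have inj: "inj_on (\<lambda>(H, Vs). V # Vs) (SIGMA H:?S. complete_flags n H)"
    by (auto simp: inj_on_def dest: complete_flags_nth_0)
  have "flag_sum q (m # lam) (Suc n) V
      = (\<Sum>(H, Vs)\<in>(SIGMA H:?S. complete_flags n H). ?F (Suc n) (m # lam) (V # Vs))"
    unfolding flag_sum_def complete_flags_Suc[OF V] sum.reindex[OF inj]
    by (simp only: comp_def case_prod_unfold)
  also have "\<dots> = (\<Sum>H\<in>?S. \<Sum>Vs\<in>complete_flags n H. ?F (Suc n) (m # lam) (V # Vs))"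
    by (rule sum.Sigma[OF finite_subspaces_card[OF fin] finS, symmetric])
  also have "\<dots> = (\<Sum>H\<in>?S. \<Sum>Vs\<in>complete_flags n H.
      prod_nz (quot_sp V H) ^ ((q ^ m - 1) div (q - 1)) * ?F n lam Vs)"
    unfolding split by (intro sum.cong refl) (simp add: complete_flags_nth_0)
  finally show ?thesis
    by (simp add: flag_sum_def sum_distrib_left)
qed

section \<open>Signs and exponents\<close>

lemma q_geometric: "(q ^ m - 1) div (q - 1) = (\<Sum>i<m. q ^ i)"
proof -
  have "(\<Sum>i<m. q ^ i) * (q - 1) + 1 = q ^ m"
  proof (induction m)
    case (Suc m)
    have "(\<Sum>i<Suc m. q ^ i) * (q - 1) + 1 = ((\<Sum>i<m. q ^ i) * (q - 1) + 1) + q ^ m * (q - 1)"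
      by (simp add: algebra_simps)
    also have "\<dots> = q ^ m * Suc (q - 1)"
      unfolding Suc by simp
    finally show ?case
      using q_ge_2 by simp
  qed simp
  then have "q ^ m - 1 = (\<Sum>i<m. q ^ i) * (q - 1)"
    by (metis add_diff_cancel_right')
  then show ?thesis
    using q_ge_2 by simp
qed

text \<open>Each of the m summands q^i contributes one factor -1, also for even q, where 1 = -1 in
  S.\<close>

lemma minus_1_pow_geometric: "(- 1 :: 'a mpoly) ^ (\<Sum>i<m. q ^ i) = (- 1) ^ m"
  by (induction m) (simp_all add: power_add minus_1_pow_q_pow)

text \<open>As f_H kills H and is linear, the quotient is the line spanned by f_H(v), and
  \<open>prod_scale_nz\<close> gives the product.\<close>

lemma prod_nz_quot_line:
  fixes H :: "'a mpoly set"
  assumes H: "fq_subspace H" "card H = q ^ n" and v: "v \<notin> H"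
  shows "prod_nz (quot_sp (adjoin v H) H) = - (fW H v ^ (q - 1))"
proof -
  have fin: "finite H"
    using H finite_card_q_pow by blast
  have lin: "fq_linear (fW H)"
    by (rule fq_linear_fW[OF H])
  have nz: "fW H v \<noteq> 0"
    by (rule fW_neq_0[OF H(1) fin v])
  have "quot_sp (adjoin v H) H = range (\<lambda>c. const c * fW H v)"
  proof (rule equalityI; rule subsetI)
    fix x assume "x \<in> quot_sp (adjoin v H) H"
    then obtain c h where "h \<in> H" "x = fW H (const c * v + h)"
      by (auto simp: quot_sp_def mem_adjoin)
    then show "x \<in> range (\<lambda>c. const c * fW H v)"
      using fW_eq_0[OF H(1) fin] by (auto simp: fq_linear_add[OF lin] fq_linear_scale[OF lin])
  next
    fix x assume "x \<in> range (\<lambda>c. const c * fW H v)"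
    then obtain c where "x = fW H (const c * v + 0)"
      by (auto simp: fq_linear_scale[OF lin])
    moreover have "const c * v + 0 \<in> adjoin v H"
      using fq_subspace_0[OF H(1)] unfolding mem_adjoin by blast
    ultimately show "x \<in> quot_sp (adjoin v H) H"
      by (simp add: quot_sp_def)
  qed
  then have "quot_sp (adjoin v H) H - {0} = (\<lambda>c. const c * fW H v) ` (UNIV - {0})"
    using nz by auto
  then show ?thesis
    unfolding prod_nz_def using prod_scale_nz[of "fW H v"]
    by (simp add: prod.reindex[OF inj_scale[OF nz]])
qed

lemma prod_nz_quot_line_power:
  fixes H :: "'a mpoly set"
  assumes "fq_subspace H" "card H = q ^ n" "v \<notin> H"
  shows "prod_nz (quot_sp (adjoin v H) H) ^ ((q ^ m - 1) div (q - 1))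
    = (- 1) ^ m * fW H v ^ (q ^ m - 1)"
proof -
  \<comment> \<open>The division of natural numbers in the exponent is exact.\<close>
  have dvd: "(q - 1) * ((q ^ m - 1) div (q - 1)) = q ^ m - 1"
    using power_diff_1_eq[of "int q" m] q_ge_2
    by (intro dvd_mult_div_cancel) (simp flip: int_dvd_int_iff add: of_nat_diff)
  have "(- (fW H v ^ (q - 1))) ^ ((q ^ m - 1) div (q - 1))
      = (- 1) ^ ((q ^ m - 1) div (q - 1)) * fW H v ^ (q ^ m - 1)"
    by (subst power_minus) (simp only: power_mult[symmetric] dvd)
  then show ?thesis
    unfolding prod_nz_quot_line[OF assms] q_geometric minus_1_pow_geometric .
qed

section \<open>Induction on the dimension\<close>

text \<open>The theorem with the denominator cleared, for any basis \<open>ws\<close>, because the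
  induction hypothesis is applied to bases of hyperplanes.\<close>

lemma Aalt_eq_flag_sum:
  fixes ws :: "'a mpoly list"
  assumes "length ws = n" "length lam = n" "card (lspan ws) = q ^ n"
  shows "Aalt q ws (map2 (+) lam (delta n))
    = Aalt q ws (delta n) * ((- 1) ^ sum_list lam * flag_sum q lam n (lspan ws))"
  using assms
proof (induction n arbitrary: ws lam)
  case 0
  then show ?case
    by (simp add: delta_def lspan_Nil flag_sum_def complete_flags_0)
next
  case (Suc n)
  obtain m lam' where lam: "lam = m # lam'" "length lam' = n"
    using Suc.prems(2) by (cases lam) auto
  let ?V = "lspan ws" and ?\<beta> = "map2 (+) lam' (delta n)"
  have summand: "alt (Suc n) (case_nat (\<lambda>x. fW H x ^ (q ^ m)) (\<lambda>j x. x ^ (q ^ (?\<beta> ! j)))) ws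
      = Aalt q ws (delta (Suc n)) * ((- 1) ^ sum_list lam *
          (prod_nz (quot_sp ?V H) ^ ((q ^ m - 1) div (q - 1)) * flag_sum q lam' n H))"
    if H: "H \<in> subspaces_card (q ^ n) ?V" for H
  proof -
    have H: "fq_subspace H" "H \<subseteq> ?V" "card H = q ^ n"
      using H by (auto simp: subspaces_card_def)
    obtain hs where hs: "length hs = n" "lspan hs = H"
      using ex_lspan[OF H(1,3)] by blast
    have "card H < card ?V"
      using H Suc.prems q_ge_2 by simp
    then obtain v where v: "v \<in> ?V" "v \<notin> H"
      using H by (metis psubsetI less_irrefl psubset_imp_ex_mem DiffE)
    have V: "?V = adjoin v H"
      using adjoin_eq[OF fq_subspace_lspan H(1,2) v _ finite_card_q_pow[OF Suc.prems(3)]] H Suc.prems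
      by simp
    define t where "t = (- 1) ^ sum_list lam' * flag_sum q lam' n H"
    have "Aalt q hs ?\<beta> = Aalt q hs (delta n) * t"
      unfolding t_def hs(2)[symmetric] by (rule Suc.IH) (use hs H lam in auto)
    then have "alt (Suc n) (case_nat (\<lambda>x. fW H x ^ (q ^ m)) (\<lambda>j x. x ^ (q ^ (?\<beta> ! j)))) ws
        = Aalt q ws (delta (Suc n)) * (fW H v ^ (q ^ m - 1) * t)"
      using alt_hyperplane_term[of ws n hs v ?\<beta> t m] hs H V Suc.prems by (simp add: lspan_Cons)
    also have "fW H v ^ (q ^ m - 1) * t = (- 1) ^ sum_list lam *
        (((- 1) ^ m * fW H v ^ (q ^ m - 1)) * flag_sum q lam' n H)"
      unfolding t_def lam by (simp add: power_add flip: power_mult_distrib)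
    also have "(- 1) ^ m * fW H v ^ (q ^ m - 1) = prod_nz (quot_sp ?V H) ^ ((q ^ m - 1) div (q - 1))"
      unfolding V using prod_nz_quot_line_power[OF H(1,3) v(2)] by simp
    finally show ?thesis .
  qed
  have "Aalt q ws (map2 (+) lam (delta (Suc n))) = Aalt q ws ((m + n) # ?\<beta>)"
    by (simp add: lam delta_Suc)
  also have "\<dots> = (\<Sum>H\<in>subspaces_card (q ^ n) ?V.
      alt (Suc n) (case_nat (\<lambda>x. fW H x ^ (q ^ m)) (\<lambda>j x. x ^ (q ^ (?\<beta> ! j)))) ws)"
    by (rule Aalt_expand_hyperplanes[OF Suc.prems(1,3)])
  also have "\<dots> = (\<Sum>H\<in>subspaces_card (q ^ n) ?V.
      Aalt q ws (delta (Suc n)) * ((- 1) ^ sum_list lam *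
          (prod_nz (quot_sp ?V H) ^ ((q ^ m - 1) div (q - 1)) * flag_sum q lam' n H)))"
    by (rule sum.cong[OF refl summand])
  also have "\<dots> = Aalt q ws (delta (Suc n)) * ((- 1) ^ sum_list lam * flag_sum q lam (Suc n) ?V)"
    unfolding lam(1) flag_sum_Suc[OF fq_subspace_lspan Suc.prems(3)]
    by (simp only: sum_distrib_left)
  finally show ?case .
qed

text \<open>Since S has no zero divisors and A_delta is nonzero, the multiplied identity determines
  the quotient in \<open>moore_schur\<close>.\<close>

lemma moore_schur_vars_eq_flag_sum:
  assumes "length lam = n"
  shows "moore_schur q (map var [0..<n] :: 'a mpoly list) lam
    = (- 1) ^ sum_list lam * flag_sum q lam n (varspan n)"
proof -
  let ?ws = "map var [0..<n] :: 'a mpoly list"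
  have card: "card (lspan ?ws) = q ^ n"
    using card_varspan[of n] by (simp add: varspan_eq_lspan)
  have nz: "Aalt q ?ws (delta n) \<noteq> 0"
    using Aalt_delta_neq_0[of ?ws] card by simp
  have "Aalt q ?ws (map2 (+) lam (delta n))
      = ((- 1) ^ sum_list lam * flag_sum q lam n (varspan n)) * Aalt q ?ws (delta n)"
    using Aalt_eq_flag_sum[of ?ws n lam] card assms by (simp add: varspan_eq_lspan mult.commute)
  then show ?thesis
    unfolding moore_schur_def using nz by (intro the_equality) auto
qed

end

theorem mainTheorem7:
  fixes lam :: "nat list" and n :: nat
  assumes "length lam = n"
    and "sorted_wrt (\<ge>) lam"
  defines "q \<equiv> card (UNIV :: 'a::{field,finite} set)"
  shows "moore_schur q (map var [0..<n] :: 'a mpoly list) lam =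
    (-1) ^ sum_list lam *
    (\<Sum>Vs\<in>complete_flags n (varspan n :: 'a mpoly set).
       \<Prod>i\<in>{1..n}. prod_nz (quot_sp (Vs ! (i - 1)) (Vs ! i)) ^ ((q ^ (lam ! (i - 1)) - 1) div (q - 1)))"
proof -
  interpret finite_field_mpoly q "TYPE('a)"
    by unfold_locales (simp add: q_def)
  show ?thesis
    using moore_schur_vars_eq_flag_sum[OF assms(1)] by (simp add: flag_sum_def)
qed

end
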